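(* Let $-1\le R\le 1$ and let $\boldsymbol{u}(t)\in\mathbb{R}^{N+1}$, together with the scalar functions $u_0^*(t),u_N^*(t)$, solve the semidiscretization $$\ddot{\boldsymbol{u}} = \boldsymbol{D}_{11}\boldsymbol{u}+\sum_{k\in\{0,N\}}\Big(\boldsymbol{H}^{-1}\boldsymbol{e}_k\big(\tau_k^*-n_k\boldsymbol{b}_k^T\boldsymbol{u}\big)-n_k\boldsymbol{H}^{-1}\boldsymbol{b}_k\big(u_k^*-u_k\big)\Big)$$ with the characteristic numerical fluxes, for $k\in\{0,N\}$, $$\dot u_k^*=\frac{q_k^*+w_k^*}{2},\qquad \tau_k^*=\frac{q_k^*-w_k^*}{2},\qquad w_k^*=\dot u_k-\tau_k,\qquad q_k^*=R\,w_k^*,$$ where $\tau_k=n_k\boldsymbol{b}_k^T\boldsymbol{u}+\gamma(u_k^*-u_k)$ and $\gamma>0$ (so that $u_k^*$ is an additional unknown evolved in time). Then the energy $$\mathcal{E}=\frac12\Big(\dot{\boldsymbol{u}}^T\boldsymbol{H}\dot{\boldsymbol{u}}+\boldsymbol{u}^T\boldsymbol{A}_{11}\boldsymbol{u}\Big)+\frac{1}{2\gamma}\sum_{k\in\{0,N\}}\Big(\tau_k^2-(\boldsymbol{b}_k^T\boldsymbol{u})^2\Big)$$ satisfies $\dot{\mathcal{E}}\le 0$.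
   Context: One-dimensional summation-by-parts (SBP) setting: the interval $[0,1]$ has $N+1$ equally spaced grid points indexed $0,\dots,N$ ($N\ge1$); $\boldsymbol{e}_k\in\mathbb{R}^{N+1}$ is the vector equal to $1$ at grid point $k$ and $0$ elsewhere, and $u_k=\boldsymbol{e}_k^T\boldsymbol{u}$. $\boldsymbol{H}$ is a diagonal positive definite matrix. $\boldsymbol{D}_{11}$ (an approximation of the second derivative) is an SBP operator: $\boldsymbol{H}\boldsymbol{D}_{11}=-\boldsymbol{A}_{11}+\boldsymbol{e}_N\boldsymbol{b}_N^T-\boldsymbol{e}_0\boldsymbol{b}_0^T$ with $\boldsymbol{A}_{11}$ symmetric positive semidefinite and $\boldsymbol{b}_0,\boldsymbol{b}_N\in\mathbb{R}^{N+1}$ vectors such that $\boldsymbol{b}_k^T\boldsymbol{u}$ approximates the first derivative at the corresponding endpoint. The outward normals are $n_0=-1$, $n_N=1$. Dots denote time derivatives. $R$ is the reflection coefficient. *)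

theory Defs
  imports "HOL-Analysis.Analysis"
begin

text \<open>
  The grid points \<open>0, \<dots>, N\<close> are the elements, in increasing order, of a finite linearly ordered
  type \<open>'n\<close> with \<open>CARD('n) = N + 1\<close>, so that grid functions are vectors in \<open>real ^ 'n\<close>.
  Objects attached to the two boundary points (\<open>b\<^sub>k\<close>, \<open>u\<^sub>k\<^sup>*\<close>) are families
  indexed by \<open>'n\<close>, of which only the members at the first and the last point are ever used.
\<close>

type_synonym 'n rvec = "(real, 'n) vec"
type_synonym 'n rmat = "((real, 'n) vec, 'n) vec"

definition pt0 :: "'n::{finite,linorder}" where
  "pt0 = Min UNIV"

definition ptN :: "'n::{finite,linorder}" where
  "ptN = Max UNIV"

definition boundary :: "'n::{finite,linorder} set" where
  "boundary = {pt0, ptN}"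

text \<open>The outward normal is meaningful at boundary points only, and \<open>pt0 \<noteq> ptN\<close> when \<open>N \<ge> 1\<close>.\<close>

definition normal :: "'n::{finite,linorder} \<Rightarrow> real" where
  "normal k = (if k = pt0 then -1 else 1)"

abbreviation e :: "'n::finite \<Rightarrow> 'n rvec" where
  "e k \<equiv> axis k 1"

definition outer :: "'n::finite rvec \<Rightarrow> 'n rvec \<Rightarrow> 'n rmat" where
  "outer v w = (\<chi> i j. v $ i * w $ j)"

definition diagonal_matrix :: "'n::finite rmat \<Rightarrow> bool" where
  "diagonal_matrix M \<longleftrightarrow> (\<forall>i j. i \<noteq> j \<longrightarrow> M $ i $ j = 0)"

definition symmetric_matrix :: "'n::finite rmat \<Rightarrow> bool" where
  "symmetric_matrix M \<longleftrightarrow> transpose M = M"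

definition pos_def :: "'n::finite rmat \<Rightarrow> bool" where
  "pos_def M \<longleftrightarrow> symmetric_matrix M \<and> (\<forall>x. x \<noteq> 0 \<longrightarrow> x \<bullet> (M *v x) > 0)"

definition pos_semidef :: "'n::finite rmat \<Rightarrow> bool" where
  "pos_semidef M \<longleftrightarrow> symmetric_matrix M \<and> (\<forall>x. x \<bullet> (M *v x) \<ge> 0)"

text \<open>
  Only the algebraic summation-by-parts property is recorded. That \<open>D\<close> and \<open>b\<^sub>k\<close> approximate
  the second and the first derivative is an accuracy property of unspecified order.
\<close>

definition sbp_operator ::
  "'n rmat \<Rightarrow> 'n rmat \<Rightarrow> 'n rmat \<Rightarrow> ('n::{finite,linorder} \<Rightarrow> 'n rvec) \<Rightarrow> bool"
where
  "sbp_operator H D A b \<longleftrightarrow>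
     diagonal_matrix H \<and> pos_def H \<and> pos_semidef A \<and>
     H ** D = - A + outer (e ptN) (b ptN) - outer (e pt0) (b pt0)"

text \<open>
  In the next definitions \<open>u\<close>, \<open>v\<close> and \<open>us\<close> are the values at one instant of the solution, of its
  time derivative, and of \<open>u\<^sub>k\<^sup>*\<close>.
\<close>

definition tau ::
  "real \<Rightarrow> ('n::{finite,linorder} \<Rightarrow> 'n rvec) \<Rightarrow> 'n rvec \<Rightarrow> ('n \<Rightarrow> real) \<Rightarrow> 'n \<Rightarrow> real" where
  "tau \<gamma> b u us k = normal k * (b k \<bullet> u) + \<gamma> * (us k - u $ k)"

definition w_star ::
  "real \<Rightarrow> ('n::{finite,linorder} \<Rightarrow> 'n rvec) \<Rightarrow> 'n rvec \<Rightarrow> 'n rvec \<Rightarrow> ('n \<Rightarrow> real) \<Rightarrow> 'n \<Rightarrow> real"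
where
  "w_star \<gamma> b u v us k = v $ k - tau \<gamma> b u us k"

definition q_star ::
  "real \<Rightarrow> real \<Rightarrow> ('n::{finite,linorder} \<Rightarrow> 'n rvec) \<Rightarrow> 'n rvec \<Rightarrow> 'n rvec \<Rightarrow> ('n \<Rightarrow> real) \<Rightarrow>
    'n \<Rightarrow> real"
where
  "q_star R \<gamma> b u v us k = R * w_star \<gamma> b u v us k"

definition tau_star ::
  "real \<Rightarrow> real \<Rightarrow> ('n::{finite,linorder} \<Rightarrow> 'n rvec) \<Rightarrow> 'n rvec \<Rightarrow> 'n rvec \<Rightarrow> ('n \<Rightarrow> real) \<Rightarrow>
    'n \<Rightarrow> real"
where
  "tau_star R \<gamma> b u v us k = (q_star R \<gamma> b u v us k - w_star \<gamma> b u v us k) / 2"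

definition semidisc_rhs ::
  "'n rmat \<Rightarrow> 'n rmat \<Rightarrow> ('n::{finite,linorder} \<Rightarrow> 'n rvec) \<Rightarrow>
    'n rvec \<Rightarrow> ('n \<Rightarrow> real) \<Rightarrow> ('n \<Rightarrow> real) \<Rightarrow> 'n rvec"
where
  "semidisc_rhs H D b u us taus =
     D *v u +
     (\<Sum>k\<in>boundary.
        (taus k - normal k * (b k \<bullet> u)) *\<^sub>R (matrix_inv H *v e k)
        - (normal k * (us k - u $ k)) *\<^sub>R (matrix_inv H *v b k))"

text \<open>
  \<open>v\<close> is the time derivative of \<open>u\<close>. At an endpoint of the time interval \<open>T\<close> that belongs to \<open>T\<close>
  the derivatives are one-sided.
\<close>

definition semidisc_solution ::
  "real set \<Rightarrow> 'n rmat \<Rightarrow> 'n rmat \<Rightarrow> ('n::{finite,linorder} \<Rightarrow> 'n rvec) \<Rightarrow>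
    real \<Rightarrow> real \<Rightarrow> (real \<Rightarrow> 'n rvec) \<Rightarrow> (real \<Rightarrow> 'n rvec) \<Rightarrow> ('n \<Rightarrow> real \<Rightarrow> real) \<Rightarrow> bool"
where
  "semidisc_solution T H D b R \<gamma> u v us \<longleftrightarrow>
     (\<forall>t\<in>T.
        (u has_vector_derivative v t) (at t within T) \<and>
        (v has_vector_derivative
           semidisc_rhs H D b (u t) (\<lambda>k. us k t) (tau_star R \<gamma> b (u t) (v t) (\<lambda>k. us k t)))
          (at t within T) \<and>
        (\<forall>k\<in>boundary.
           (us k has_real_derivative
              (q_star R \<gamma> b (u t) (v t) (\<lambda>k. us k t) k
               + w_star \<gamma> b (u t) (v t) (\<lambda>k. us k t) k) / 2)
             (at t within T)))"

definition energy ::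
  "'n rmat \<Rightarrow> 'n rmat \<Rightarrow> ('n::{finite,linorder} \<Rightarrow> 'n rvec) \<Rightarrow> real \<Rightarrow>
    'n rvec \<Rightarrow> 'n rvec \<Rightarrow> ('n \<Rightarrow> real) \<Rightarrow> real"
where
  "energy H A b \<gamma> u v us =
     1 / 2 * (v \<bullet> (H *v v) + u \<bullet> (A *v u))
     + 1 / (2 * \<gamma>) * (\<Sum>k\<in>boundary. (tau \<gamma> b u us k)\<^sup>2 - (b k \<bullet> u)\<^sup>2)"

end

theory Submission
  imports Defs
begin

text \<open>
  Differentiate the energy and write \<open>v\<close> for the time derivative of \<open>u\<close>. The summation-by-parts
  identity turns the interior work \<open>v\<^sup>T H D u\<close> into \<open>- v\<^sup>T A u\<close>, which cancels the rate of the
  potential energy, plus boundary terms. The term \<open>n\<^sub>k b\<^sub>k\<^sup>T u\<close> of the flux penalty cancels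
  those boundary terms, so the rate of the interior energy consists, at each boundary point, of the
  flux work \<open>v\<^sub>k \<tau>\<^sub>k\<^sup>*\<close> and the term \<open>- n\<^sub>k (b\<^sub>k\<^sup>T v) (u\<^sub>k\<^sup>* - u\<^sub>k)\<close>, which has no sign
  (\<open>sbp_energy_balance\<close>).

  The boundary part of the energy is there to absorb the latter term: because
  \<open>\<gamma> (u\<^sub>k\<^sup>* - u\<^sub>k) = \<tau>\<^sub>k - n\<^sub>k b\<^sub>k\<^sup>T u\<close> and \<open>n\<^sub>k\<^sup>2 = 1\<close>, every product with \<open>b\<^sub>k\<^sup>T v\<close> drops
  out of the total rate. What remains at each boundary point involves only \<open>v\<^sub>k\<close>, \<open>\<tau>\<^sub>k\<close> and the
  fluxes, and the characteristic choice of the fluxes makes it equal to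
  \<open>- ((1 - R) v\<^sub>k\<^sup>2 + (1 + R) \<tau>\<^sub>k\<^sup>2) / 2\<close> (\<open>boundary_energy_rate\<close>). Both weights are nonnegative
  exactly when \<open>\<bar>R\<bar> \<le> 1\<close>.
\<close>

lemma symmetric_matrix_inner_commute:
  assumes "symmetric_matrix M"
  shows "x \<bullet> (M *v y) = y \<bullet> (M *v x)"
proof -
  have "x v* M = M *v x"
    using assms transpose_matrix_vector[of M x] by (simp add: symmetric_matrix_def)
  then show ?thesis
    using dot_lmul_matrix[of x M y] by (simp add: inner_commute)
qed

lemma pos_def_imp_invertible:
  assumes "pos_def M"
  shows "invertible M"
proof -
  have "x = 0" if "M *v x = 0" for x
    using assms that by (force simp: pos_def_def)
  then show ?thesis
    by (simp add: invertible_left_inverse matrix_left_invertible_ker)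
qed

lemma outer_mult_vector: "outer x y *v z = (y \<bullet> z) *\<^sub>R x"
  by (simp add: vec_eq_iff outer_def matrix_vector_mult_def inner_vec_def sum_distrib_left
      mult_ac)

lemma has_real_derivative_quadratic_form:
  assumes "symmetric_matrix M" "(x has_vector_derivative x') (at t within T)"
  shows "((\<lambda>s. x s \<bullet> (M *v x s)) has_real_derivative 2 * (x t \<bullet> (M *v x'))) (at t within T)"
proof -
  have "((\<lambda>s. M *v x s) has_vector_derivative M *v x') (at t within T)"
    using matrix_vector_mul_bounded_linear assms(2) by (rule bounded_linear.has_vector_derivative)
  with assms(2) have "((\<lambda>s. x s \<bullet> (M *v x s)) has_vector_derivative
      x t \<bullet> (M *v x') + x' \<bullet> (M *v x t)) (at t within T)"
    by (rule bounded_bilinear.has_vector_derivative[OF bounded_bilinear_inner])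
  then show ?thesis
    by (simp add: has_real_derivative_iff_has_vector_derivative
        symmetric_matrix_inner_commute[OF assms(1), of x'])
qed

lemma pt0_neq_ptN:
  assumes "CARD('n::{finite,linorder}) \<ge> 2"
  shows "(pt0 :: 'n) \<noteq> ptN"
proof
  assume eq: "(pt0 :: 'n) = ptN"
  have "x = pt0" for x :: 'n
    using Min_le[of UNIV x] Max_ge[of UNIV x] eq unfolding pt0_def ptN_def
    by (intro antisym) simp_all
  then have "(UNIV :: 'n set) = {pt0}" by blast
  then have "CARD('n) = 1" by (metis card_1_singleton_iff One_nat_def)
  with assms show False by simp
qed

lemma normal_squared: "normal k * normal k = 1"
  by (simp add: normal_def)

text \<open>
  With a single grid point the two boundary terms of \<open>H D\<close> would not be the two summands on the
  right; distinct end points also make the normal at the last one equal to \<open>1\<close>.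
\<close>

lemma summation_by_parts:
  fixes H D A :: "'n::{finite,linorder} rmat"
  assumes "CARD('n) \<ge> 2" "sbp_operator H D A b"
  shows "v \<bullet> (H *v (D *v u))
    = - (v \<bullet> (A *v u)) + (\<Sum>k\<in>boundary. normal k * v $ k * (b k \<bullet> u))"
proof -
  have "H *v (D *v u) = (H ** D) *v u"
    by (simp add: matrix_vector_mul_assoc)
  also have "\<dots> = - (A *v u) + (b ptN \<bullet> u) *\<^sub>R e ptN - (b pt0 \<bullet> u) *\<^sub>R e pt0"
    using assms(2)
    by (simp add: sbp_operator_def matrix_vector_mult_add_rdistrib
        matrix_vector_mult_diff_rdistrib outer_mult_vector)
  finally have "v \<bullet> (H *v (D *v u))
      = v \<bullet> (- (A *v u) + (b ptN \<bullet> u) *\<^sub>R e ptN - (b pt0 \<bullet> u) *\<^sub>R e pt0)"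
    by simp
  then show ?thesis
    using pt0_neq_ptN[OF assms(1)]
    by (simp add: boundary_def normal_def inner_diff_right inner_add_right inner_axis algebra_simps)
qed

text \<open>
  Testing the semidiscretization with \<open>H v\<close> removes \<open>H\<inverse>\<close> from the penalty terms; the flux penalty
  \<open>- n\<^sub>k b\<^sub>k\<^sup>T u\<close> is the one that cancels the boundary terms of the summation by parts.
\<close>

lemma sbp_energy_balance:
  fixes H D A :: "'n::{finite,linorder} rmat"
  assumes "CARD('n) \<ge> 2" "sbp_operator H D A b"
  shows "v \<bullet> (H *v semidisc_rhs H D b u us taus) + v \<bullet> (A *v u)
    = (\<Sum>k\<in>boundary. v $ k * taus k - normal k * (b k \<bullet> v) * (us k - u $ k))"
proof -
  have "invertible H"
    using assms(2) by (simp add: sbp_operator_def pos_def_imp_invertible)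
  then have "H ** matrix_inv H = mat 1"
    using someI_ex[of "\<lambda>M. H ** M = mat 1 \<and> M ** H = mat 1"]
    unfolding invertible_def matrix_inv_def by blast
  then have inv: "H *v (matrix_inv H *v x) = x" for x
    by (simp add: matrix_vector_mul_assoc)
  have "H *v semidisc_rhs H D b u us taus = H *v (D *v u) +
      (\<Sum>k\<in>boundary. (taus k - normal k * (b k \<bullet> u)) *\<^sub>R e k
        - (normal k * (us k - u $ k)) *\<^sub>R b k)"
    using pt0_neq_ptN[OF assms(1)]
    by (simp add: semidisc_rhs_def boundary_def matrix_vector_right_distrib
        matrix_vector_mult_diff_distrib matrix_vector_mult_scaleR inv)
  then have "v \<bullet> (H *v semidisc_rhs H D b u us taus) = v \<bullet> (H *v (D *v u)) +
      (\<Sum>k\<in>boundary. (taus k - normal k * (b k \<bullet> u)) * v $ k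
        - normal k * (us k - u $ k) * (b k \<bullet> v))"
    by (simp add: inner_add_right inner_sum_right inner_diff_right inner_axis
        inner_commute[of v "b _"])
  then show ?thesis
    by (simp add: summation_by_parts[OF assms] algebra_simps sum.distrib sum_subtractf)
qed

text \<open>
  The left-hand side is the contribution of one boundary point to the energy rate, with \<open>\<beta>\<close> and
  \<open>\<beta>'\<close> for \<open>b\<^sub>k\<^sup>T u\<close> and \<open>b\<^sub>k\<^sup>T v\<close>, \<open>d\<close> for \<open>u\<^sub>k\<^sup>* - u\<^sub>k\<close>, \<open>p\<close> for \<open>v\<^sub>k\<close> and
  \<open>w\<close> for the outgoing characteristic. The products with \<open>\<beta>'\<close> cancel, which leaves
  \<open>p \<tau>\<^sup>* + \<tau> (u\<^sup>*' - p)\<close>.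
\<close>

lemma boundary_energy_rate:
  fixes n \<beta> \<beta>' \<gamma> d p R \<tau> w :: real
  assumes "\<gamma> \<noteq> 0" "n * n = 1" "\<tau> = n * \<beta> + \<gamma> * d" "w = p - \<tau>"
  shows "p * ((R * w - w) / 2) - n * \<beta>' * d
      + 1 / \<gamma> * (\<tau> * (n * \<beta>' + \<gamma> * ((R * w + w) / 2 - p)) - \<beta> * \<beta>')
    = - ((1 - R) * p\<^sup>2 + (1 + R) * \<tau>\<^sup>2) / 2"
proof -
  have "\<tau> * (n * \<beta>') - \<beta> * \<beta>' = (n * n) * \<beta> * \<beta>' - \<beta> * \<beta>' + \<gamma> * (n * \<beta>' * d)"
    unfolding assms(3) by (simp add: algebra_simps)
  then have cancel: "\<tau> * (n * \<beta>') - \<beta> * \<beta>' = \<gamma> * (n * \<beta>' * d)"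
    using assms(2) by simp
  have "1 / \<gamma> * (\<tau> * (n * \<beta>' + \<gamma> * ((R * w + w) / 2 - p)) - \<beta> * \<beta>')
      = 1 / \<gamma> * (\<gamma> * (n * \<beta>' * d + \<tau> * ((R * w + w) / 2 - p)))"
    unfolding distrib_left cancel[symmetric] by (simp add: algebra_simps)
  also have "\<dots> = n * \<beta>' * d + \<tau> * ((R * w + w) / 2 - p)"
    using assms(1) by simp
  finally have reduced: "1 / \<gamma> * (\<tau> * (n * \<beta>' + \<gamma> * ((R * w + w) / 2 - p)) - \<beta> * \<beta>')
      = n * \<beta>' * d + \<tau> * ((R * w + w) / 2 - p)" .
  show ?thesis
    unfolding reduced by (simp add: assms(4) power2_eq_square field_simps)
qed

lemma tau_has_real_derivative:
  assumes "(u has_vector_derivative v) (at t within T)"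
    and "(us k has_real_derivative us') (at t within T)"
  shows "((\<lambda>s. tau \<gamma> b (u s) (\<lambda>k. us k s) k) has_real_derivative
    normal k * (b k \<bullet> v) + \<gamma> * (us' - v $ k)) (at t within T)"
proof -
  have "((\<lambda>s. b k \<bullet> u s) has_real_derivative b k \<bullet> v) (at t within T)"
    using bounded_linear.has_vector_derivative[OF bounded_linear_inner_right assms(1)]
    by (simp add: has_real_derivative_iff_has_vector_derivative)
  moreover have "((\<lambda>s. u s $ k) has_real_derivative v $ k) (at t within T)"
    using bounded_linear.has_vector_derivative[OF bounded_linear_vec_nth assms(1)]
    by (simp add: has_real_derivative_iff_has_vector_derivative)
  ultimately show ?thesis
    unfolding tau_def by (auto intro!: derivative_eq_intros assms(2))
qed

lemma energy_has_real_derivative: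
  assumes "symmetric_matrix H" "symmetric_matrix A"
    and u: "(u has_vector_derivative v t) (at t within T)"
    and v: "(v has_vector_derivative v') (at t within T)"
    and us: "\<And>k. k \<in> boundary \<Longrightarrow> (us k has_real_derivative us' k) (at t within T)"
  shows "((\<lambda>s. energy H A b \<gamma> (u s) (v s) (\<lambda>k. us k s)) has_real_derivative
    v t \<bullet> (H *v v') + v t \<bullet> (A *v u t)
    + 1 / \<gamma> * (\<Sum>k\<in>boundary. tau \<gamma> b (u t) (\<lambda>k. us k t) k
        * (normal k * (b k \<bullet> v t) + \<gamma> * (us' k - v t $ k)) - (b k \<bullet> u t) * (b k \<bullet> v t)))
    (at t within T)"
proof -
  let ?\<tau> = "\<lambda>k s. tau \<gamma> b (u s) (\<lambda>k. us k s) k"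
  let ?\<tau>' = "\<lambda>k. normal k * (b k \<bullet> v t) + \<gamma> * (us' k - v t $ k)"
  have bu: "((\<lambda>s. b k \<bullet> u s) has_real_derivative b k \<bullet> v t) (at t within T)" for k
    using bounded_linear.has_vector_derivative[OF bounded_linear_inner_right u]
    by (simp add: has_real_derivative_iff_has_vector_derivative)
  have "((\<lambda>s. (?\<tau> k s)\<^sup>2 - (b k \<bullet> u s)\<^sup>2) has_real_derivative
      2 * (?\<tau> k t * ?\<tau>' k - (b k \<bullet> u t) * (b k \<bullet> v t))) (at t within T)"
    if "k \<in> boundary" for k
  proof -
    have "((?\<tau> k) has_real_derivative ?\<tau>' k) (at t within T)"
      by (rule tau_has_real_derivative[where us = us, OF u us[OF that]])
    from DERIV_diff[OF DERIV_power[OF this, of 2] DERIV_power[OF bu[of k], of 2]] show ?thesis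
      by (rule DERIV_cong) (simp add: right_diff_distrib mult_ac)
  qed
  then have "((\<lambda>s. \<Sum>k\<in>boundary. (?\<tau> k s)\<^sup>2 - (b k \<bullet> u s)\<^sup>2) has_real_derivative
      2 * (\<Sum>k\<in>boundary. ?\<tau> k t * ?\<tau>' k - (b k \<bullet> u t) * (b k \<bullet> v t))) (at t within T)"
    unfolding sum_distrib_left by (rule DERIV_sum)
  note boundary_part = DERIV_cmult[OF this, of "1 / (2 * \<gamma>)"]
  note interior = DERIV_cmult[OF DERIV_add[OF
      has_real_derivative_quadratic_form[OF assms(1) v]
      has_real_derivative_quadratic_form[OF assms(2) u]], of "1 / 2"]
  from DERIV_add[OF interior boundary_part] show ?thesis
    unfolding energy_def
    by (rule DERIV_cong) (simp add: symmetric_matrix_inner_commute[OF assms(2), of "u t" "v t"])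
qed

theorem theorem3:
  fixes H D A :: "'n::{finite,linorder} rmat"
    and b :: "'n \<Rightarrow> 'n rvec"
    and R \<gamma> :: real
    and T :: "real set"
    and u v :: "real \<Rightarrow> 'n rvec"
    and us :: "'n \<Rightarrow> real \<Rightarrow> real"
  assumes "CARD('n) \<ge> 2"
    and "sbp_operator H D A b"
    and "-1 \<le> R" and "R \<le> 1"
    and "\<gamma> > 0"
    and "is_interval T" and "interior T \<noteq> {}"
    and "semidisc_solution T H D b R \<gamma> u v us"
  shows "\<forall>t\<in>T. \<exists>E'.
           ((\<lambda>s. energy H A b \<gamma> (u s) (v s) (\<lambda>k. us k s)) has_real_derivative E') (at t within T)
           \<and> E' \<le> 0"
proof (intro ballI exI conjI)
  fix t assume t: "t \<in> T"
  have sym: "symmetric_matrix H" "symmetric_matrix A"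
    using assms(2) by (simp_all add: sbp_operator_def pos_def_def pos_semidef_def)
  let ?us = "\<lambda>k. us k t"
  let ?\<tau> = "tau \<gamma> b (u t) ?us" and ?w = "w_star \<gamma> b (u t) (v t) ?us"
  let ?rate = "\<Sum>k\<in>boundary. - ((1 - R) * (v t $ k)\<^sup>2 + (1 + R) * (?\<tau> k)\<^sup>2) / 2"
  let ?v' = "semidisc_rhs H D b (u t) ?us (tau_star R \<gamma> b (u t) (v t) ?us)"
  let ?us' = "\<lambda>k. (q_star R \<gamma> b (u t) (v t) ?us k + ?w k) / 2"
  have "v t \<bullet> (H *v ?v') + v t \<bullet> (A *v u t)
      + 1 / \<gamma> * (\<Sum>k\<in>boundary. ?\<tau> k * (normal k * (b k \<bullet> v t) + \<gamma> * (?us' k - v t $ k))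
          - (b k \<bullet> u t) * (b k \<bullet> v t)) = ?rate"
    unfolding sbp_energy_balance[OF assms(1,2)] sum_distrib_left sum.distrib[symmetric]
      tau_star_def q_star_def
    by (intro sum.cong refl boundary_energy_rate normal_squared)
      (use assms(5) in \<open>simp_all add: tau_def w_star_def\<close>)
  moreover have "((\<lambda>s. energy H A b \<gamma> (u s) (v s) (\<lambda>k. us k s)) has_real_derivative
      v t \<bullet> (H *v ?v') + v t \<bullet> (A *v u t)
      + 1 / \<gamma> * (\<Sum>k\<in>boundary. ?\<tau> k * (normal k * (b k \<bullet> v t) + \<gamma> * (?us' k - v t $ k))
          - (b k \<bullet> u t) * (b k \<bullet> v t))) (at t within T)"
    by (rule energy_has_real_derivative[OF sym])
      (use assms(8) t in \<open>auto simp: semidisc_solution_def\<close>)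
  ultimately show "((\<lambda>s. energy H A b \<gamma> (u s) (v s) (\<lambda>k. us k s)) has_real_derivative ?rate)
      (at t within T)"
    by simp
  have "- ((1 - R) * (v t $ k)\<^sup>2 + (1 + R) * (?\<tau> k)\<^sup>2) / 2 \<le> 0" for k
  proof -
    have "0 \<le> (1 - R) * (v t $ k)\<^sup>2 + (1 + R) * (?\<tau> k)\<^sup>2"
      using assms(3,4) by (intro add_nonneg_nonneg[of "(1 - R) * _"] mult_nonneg_nonneg) auto
    then show ?thesis
      by (intro divide_nonpos_pos) (simp_all only: neg_le_0_iff_le zero_less_numeral)
  qed
  then show "?rate \<le> 0"
    by (rule sum_nonpos)
qed

end
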